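(* For every positive integer $n$, \[\frac{2^{n-2}}{n^2}\le \operatorname{ec}(n)\le \frac{2^{n+1}}{n}.\]
   Context: A hyperplane in $\mathbb{R}^n$ is a set $\{x\in\mathbb{R}^n : v_1x_1+\dots+v_nx_n=\alpha\}$ with $v\in\mathbb{R}^n\setminus\{0\}$ and $\alpha\in\mathbb{R}$. For $B\subseteq\{0,1\}^n$, an exact cover of $B$ is a finite set of hyperplanes whose union intersects $\{0,1\}^n$ exactly in $B$. The exact cover number $\operatorname{ec}(B)$ is the minimum size of an exact cover of $B$. Define $\operatorname{ec}(n)=\max\{\operatorname{ec}(B): B\subseteq\{0,1\}^n\}$. *)

theory Defs
  imports Complex_Main "Jordan_Normal_Form.Matrix"
begin

definition hyperplane :: "nat \<Rightarrow> real vec set \<Rightarrow> bool" where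
  "hyperplane n P \<longleftrightarrow>
     (\<exists>v \<alpha>. v \<in> carrier_vec n \<and> v \<noteq> 0\<^sub>v n \<and> P = {x \<in> carrier_vec n. v \<bullet> x = \<alpha>})"

definition cube :: "nat \<Rightarrow> real vec set" where
  "cube n = {x \<in> carrier_vec n. \<forall>i<n. x $ i \<in> {0, 1}}"

definition exact_cover :: "nat \<Rightarrow> real vec set \<Rightarrow> real vec set set \<Rightarrow> bool" where
  "exact_cover n B H \<longleftrightarrow> finite H \<and> (\<forall>P\<in>H. hyperplane n P) \<and> \<Union>H \<inter> cube n = B"

definition ec_set :: "nat \<Rightarrow> real vec set \<Rightarrow> nat" where
  "ec_set n B = (LEAST k. \<exists>H. exact_cover n B H \<and> card H = k)"

definition ec :: "nat \<Rightarrow> nat" where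
  "ec n = Max (ec_set n ` Pow (cube n))"

text \<open>
  For \<open>n \<ge> 1\<close> the minimum and the maximum above are attained: the cube is finite, and every
  subset of it has an exact cover, because each vertex is cut out by a hyperplane of its own.
  For \<open>n = 0\<close> there are no hyperplanes, and \<open>ec_set\<close> is unspecified on \<open>cube 0\<close>.
\<close>

lemma finite_cube: "finite (cube n)"
proof -
  have "cube n \<subseteq> vec_of_list ` {xs. set xs \<subseteq> {0, 1} \<and> length xs = n}"
  proof
    fix x assume x: "x \<in> cube n"
    have d: "dim_vec x = n" and e: "\<And>i. i < n \<Longrightarrow> x $ i \<in> {0, 1}"
      using x by (simp_all add: cube_def)
    have "length (list_of_vec x) = n" using d by simp
    moreover have "set (list_of_vec x) \<subseteq> {0, 1}"
    proof
      fix y assume "y \<in> set (list_of_vec x)"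
      then obtain i where "i < n" "y = x $ i"
        using d by (metis in_set_conv_nth length_list_of_vec list_of_vec_index)
      thus "y \<in> {0, 1}" using e by blast
    qed
    moreover have "x = vec_of_list (list_of_vec x)"
      by (simp add: vec_list)
    ultimately show "x \<in> vec_of_list ` {xs. set xs \<subseteq> {0, 1} \<and> length xs = n}"
      by blast
  qed
  thus ?thesis
    by (rule finite_subset) (simp add: finite_lists_length_eq)
qed

lemma vertex_hyperplane:
  assumes "n > 0" "a \<in> cube n"
  shows "\<exists>P. hyperplane n P \<and> P \<inter> cube n = {a}"
proof -
  define v where "v = vec n (\<lambda>i. 2 * a $ i - 1)"
  define P where "P = {x \<in> carrier_vec n. v \<bullet> x = v \<bullet> a}"
  have a: "a \<in> carrier_vec n" "\<And>i. i < n \<Longrightarrow> a $ i = 0 \<or> a $ i = 1"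
    using assms(2) by (auto simp: cube_def)
  have "v $ 0 \<noteq> 0"
    using a(2)[of 0] assms(1) by (auto simp: v_def)
  hence "v \<noteq> 0\<^sub>v n"
    using assms(1) by auto
  hence "hyperplane n P"
    unfolding hyperplane_def P_def by (intro exI[of _ v] exI[of _ "v \<bullet> a"]) (auto simp: v_def)
  moreover have "x = a" if x: "x \<in> P" "x \<in> cube n" for x
  proof -
    have xc: "x \<in> carrier_vec n" "\<And>i. i < n \<Longrightarrow> x $ i = 0 \<or> x $ i = 1"
      using x(2) by (auto simp: cube_def)
    have "(\<Sum>i = 0..<n. v $ i * (a $ i - x $ i)) = 0"
      using x(1) xc(1) a(1) by (simp add: P_def scalar_prod_def right_diff_distrib sum_subtractf)
    moreover have "v $ i * (a $ i - x $ i) \<ge> 0" if "i \<in> {0..<n}" for i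
      using that a(2)[of i] xc(2)[of i] by (auto simp: v_def)
    ultimately have z: "\<forall>i\<in>{0..<n}. v $ i * (a $ i - x $ i) = 0"
      by (subst (asm) sum_nonneg_eq_0_iff) auto
    have "x $ i = a $ i" if "i < n" for i
      using bspec[OF z, of i] that a(2)[of i] by (auto simp: v_def)
    thus ?thesis
      using a(1) xc(1) by (intro eq_vecI) auto
  qed
  moreover have "a \<in> P" using a(1) by (simp add: P_def)
  ultimately show ?thesis
    using assms(2) by blast
qed

lemma exact_cover_exists:
  assumes "n > 0" "B \<subseteq> cube n"
  shows "\<exists>H. exact_cover n B H"
proof -
  have "\<forall>a\<in>B. \<exists>P. hyperplane n P \<and> P \<inter> cube n = {a}"
    using vertex_hyperplane assms by blast
  then obtain f where f: "\<forall>a\<in>B. hyperplane n (f a) \<and> f a \<inter> cube n = {a}"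
    by metis
  have "\<Union>(f ` B) \<inter> cube n = (\<Union>a\<in>B. f a \<inter> cube n)" by blast
  also have "\<dots> = B" using f by simp
  finally have "exact_cover n B (f ` B)"
    using f finite_subset[OF assms(2) finite_cube] by (simp add: exact_cover_def)
  thus ?thesis ..
qed

end

theory Submission
  imports Defs "Jordan_Normal_Form.VS_Connect"
begin

text \<open>
  Lower bound: by linear algebra the trace of a hyperplane on the cube is the affine hull of at most
  \<open>n + 1\<close> of its vertices, so there are at most \<open>2 ^ (n * (n + 1) + 1)\<close> traces. Every
  one of the \<open>2 ^ 2 ^ n\<close> sets of vertices is a union of at most \<open>ec n\<close> traces.

  Upper bound: every set of neighbours of a given vertex is the trace of a hyperplane, so it suffices
  to find few vertices such that every vertex is a neighbour of one of them. If
  \<open>2 ^ r \<le> n < 2 ^ (r + 1)\<close>, the vertices for which the exclusive or of the positions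
  \<open>i < 2 ^ r\<close> of the ones vanishes have this property: flipping position \<open>i\<close> changes
  the exclusive or by \<open>i\<close>. There are \<open>2 ^ n / 2 ^ r\<close> of them.
\<close>

subsection \<open>The vertices of the cube\<close>

lemma cube_carrier: "x \<in> cube n \<Longrightarrow> x \<in> carrier_vec n"
  by (simp add: cube_def)

lemma cube_index: "x \<in> cube n \<Longrightarrow> i < n \<Longrightarrow> x $ i = 0 \<or> x $ i = 1"
  by (auto simp: cube_def)

lemma card_cube: "card (cube n) = 2 ^ n"
proof -
  have "bij_betw (\<lambda>S. vec n (\<lambda>i. if i \<in> S then 1 else 0)) (Pow {..<n}) (cube n)"
  proof (rule bij_betw_byWitness[where f' = "\<lambda>x. {i. i < n \<and> x $ i = 1}"])
    show "\<forall>x\<in>cube n. vec n (\<lambda>i. if i \<in> {i. i < n \<and> x $ i = 1} then 1 else 0) = x"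
      using cube_carrier cube_index by (intro ballI eq_vecI) fastforce+
  qed (auto simp: cube_def split: if_splits)
  from bij_betw_same_card[OF this] show ?thesis
    by (simp add: card_Pow)
qed

definition flip :: "nat \<Rightarrow> real vec \<Rightarrow> real vec" where
  "flip i x = vec (dim_vec x) (\<lambda>j. if j = i then 1 - x $ j else x $ j)"

lemma flip_cube: "x \<in> cube n \<Longrightarrow> flip i x \<in> cube n"
  by (fastforce simp: flip_def cube_def)

lemma flip_flip: "x \<in> cube n \<Longrightarrow> flip i (flip i x) = x"
  by (auto simp: flip_def)

subsection \<open>Hyperplane traces are spanned by few vertices\<close>

text \<open>The vertices in the affine hull of \<open>S\<close>, described dually by equations so
  that it compares directly with a hyperplane. Allowing \<open>v\<close> to be zero makes the hull
  of the empty set empty.\<close>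

definition cube_hull :: "nat \<Rightarrow> real vec set \<Rightarrow> real vec set" where
  "cube_hull n S =
     {x \<in> cube n. \<forall>v\<in>carrier_vec n. \<forall>\<alpha>. (\<forall>y\<in>S. v \<bullet> y = \<alpha>) \<longrightarrow> v \<bullet> x = \<alpha>}"

text \<open>An independent subset of \<open>T\<close> of largest size spans \<open>T\<close>, since
  a vector of \<open>T\<close> outside its span could be added to it; the dimension bounds its
  size.\<close>

lemma (in vec_space) small_spanning_subset:
  assumes T: "T \<subseteq> carrier_vec n"
  shows "\<exists>U\<subseteq>T. card U \<le> n \<and> T \<subseteq> span U"
proof -
  let ?P = "\<lambda>U. U \<subseteq> T \<and> lin_indpt U"
  have bound: "finite U" "card U \<le> n" if U: "?P U" for U
  proof -
    have "U \<subseteq> carrier_vec n" using U T by auto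
    from li_le_dim[OF fin_dim this conjunct2[OF U]] show "finite U" "card U \<le> n"
      by (simp_all only: dim_is_n)
  qed
  have "?P {}" by (auto simp: lin_dep_def)
  moreover have "\<forall>U. ?P U \<longrightarrow> card U < Suc n" using bound(2) by (simp add: less_Suc_eq_le)
  ultimately have "\<exists>U. ?P U \<and> (\<forall>W. ?P W \<longrightarrow> card W \<le> card U)"
    by (rule Lattices_Big.ex_has_greatest_nat)
  then obtain U where U: "?P U" and max: "\<And>W. ?P W \<Longrightarrow> card W \<le> card U"
    by metis
  have Uc: "U \<subseteq> carrier_vec n" using U T by blast
  have "x \<in> span U" if x: "x \<in> T" for x
  proof (rule ccontr)
    assume n: "x \<notin> span U"
    have xU: "x \<notin> U" using n in_own_span[OF Uc] by blast
    have "lin_indpt (U \<union> {x})"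
      using lin_dep_iff_in_span[of U x] Uc U xU n T x by auto
    hence "card (U \<union> {x}) \<le> card U"
      using max[of "U \<union> {x}"] U x by blast
    thus False using xU bound(1)[OF U] by simp
  qed
  with bound(2)[OF U] U show ?thesis by blast
qed

lemma cube_hullD:
  assumes "x \<in> cube_hull n S" "v \<in> carrier_vec n" "\<And>y. y \<in> S \<Longrightarrow> v \<bullet> y = \<alpha>"
  shows "v \<bullet> x = \<alpha>"
  using assms by (simp add: cube_hull_def)

text \<open>Prepending a coordinate 1 turns the equation with data \<open>v\<close>,
  \<open>\<alpha>\<close> into orthogonality to \<open>vCons (- \<alpha>) v\<close>, which passes
  from a set to its span. The extra dimension accounts for \<open>Suc n\<close>.\<close>

lemma small_affine_spanning_subset:
  assumes "T \<subseteq> cube n"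
  shows "\<exists>S\<subseteq>T. card S \<le> Suc n \<and> T \<subseteq> cube_hull n S"
proof -
  interpret vec_space "TYPE(real)" "Suc n" .
  let ?h = "vCons (1::real)"
  have hT: "?h ` T \<subseteq> carrier_vec (Suc n)"
    using assms cube_carrier by fastforce
  have inj: "inj_on ?h T"
    by (auto simp: inj_on_def)
  obtain U where U: "U \<subseteq> ?h ` T" "card U \<le> Suc n" "?h ` T \<subseteq> span U"
    using small_spanning_subset[OF hT] by blast
  have Uc: "U \<subseteq> carrier_vec (Suc n)" using U(1) hT by blast
  obtain S where S: "S \<subseteq> T" "U = ?h ` S"
    using U(1) by (meson subset_imageE)
  have "card S \<le> Suc n"
    using U(2) S card_image inj inj_on_subset by metis
  moreover have "x \<in> cube_hull n S" if x: "x \<in> T" for x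
  proof -
    have "v \<bullet> x = \<alpha>" if v: "v \<in> carrier_vec n" and eq: "\<forall>y\<in>S. v \<bullet> y = \<alpha>" for v \<alpha>
    proof -
      have "vCons (- \<alpha>) v \<in> orthogonal_complement U"
        using v eq S by (auto simp: orthogonal_complement_def)
      hence "vCons (- \<alpha>) v \<in> orthogonal_complement (span U)"
        using in_orthogonal_complement_span[OF Uc] by simp
      hence "vCons (- \<alpha>) v \<bullet> ?h x = 0"
        using U(3) x unfolding orthogonal_complement_def by blast
      thus ?thesis by simp
    qed
    thus ?thesis using x assms by (auto simp: cube_hull_def)
  qed
  ultimately show ?thesis using S(1) by blast
qed

text \<open>The equation of \<open>P\<close> is one of those that define the hull of a subset of
  \<open>P\<close>, so this hull stays inside \<open>P\<close>.\<close>

lemma hyperplane_trace_hull: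
  assumes "hyperplane n P"
  shows "\<exists>S\<subseteq>cube n. card S \<le> Suc n \<and> (S = {} \<longrightarrow> P \<inter> cube n = {}) \<and> P \<inter> cube n = cube_hull n S"
proof -
  obtain v \<alpha> where v: "v \<in> carrier_vec n" "v \<noteq> 0\<^sub>v n" "P = {x \<in> carrier_vec n. v \<bullet> x = \<alpha>}"
    using assms by (auto simp: hyperplane_def)
  obtain S where S: "S \<subseteq> P \<inter> cube n" "card S \<le> Suc n" "P \<inter> cube n \<subseteq> cube_hull n S"
    using small_affine_spanning_subset[of "P \<inter> cube n" n] by blast
  have "cube_hull n S \<subseteq> P \<inter> cube n"
  proof
    fix x assume x: "x \<in> cube_hull n S"
    hence "x \<in> cube n" by (simp add: cube_hull_def)
    moreover have "v \<bullet> x = \<alpha>"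
      by (rule cube_hullD[OF x v(1)]) (use S(1) v(3) in auto)
    ultimately show "x \<in> P \<inter> cube n" using v(3) cube_carrier by simp
  qed
  \<comment> \<open>With the zero vector, both values 0 and 1 hold vacuously on the empty
    set.\<close>
  moreover have "x \<notin> cube_hull n {}" for x
    using cube_hullD[of x n "{}" "0\<^sub>v n" 0] cube_hullD[of x n "{}" "0\<^sub>v n" 1] by auto
  ultimately have "P \<inter> cube n = cube_hull n S" "S = {} \<longrightarrow> P \<inter> cube n = {}"
    using S(3) by blast+
  thus ?thesis using S(1,2) by blast
qed

subsection \<open>The lower bound\<close>

text \<open>Padding with \<open>z\<close> lets sets of bounded size be counted as lists of one fixed
  length.\<close>

lemma list_of_length_covering:
  assumes "finite X" "card X \<le> k"
  shows "\<exists>xs. length xs = k \<and> X \<subseteq> set xs \<and> set xs \<subseteq> insert z X"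
proof -
  obtain ys where ys: "set ys = X" "distinct ys"
    using finite_distinct_list[OF assms(1)] by blast
  have "length ys \<le> k" using ys assms(2) distinct_card by metis
  thus ?thesis using ys(1)
    by (intro exI[of _ "ys @ replicate (k - length ys) z"]) auto
qed

text \<open>There are \<open>(2 ^ n) ^ (n + 1)\<close> lists of \<open>n + 1\<close> vertices; the
  empty trace adds one more set, absorbed by a factor 2.\<close>

lemma card_hyperplane_traces:
  "finite (insert {} {P \<inter> cube n |P. hyperplane n P})"
  "card (insert {} {P \<inter> cube n |P. hyperplane n P}) \<le> 2 ^ (n * (n + 1) + 1)"
proof -
  let ?F = "insert {} {P \<inter> cube n |P. hyperplane n P}"
  let ?L = "{xs. set xs \<subseteq> cube n \<and> length xs = Suc n}"
  let ?G = "insert {} ((\<lambda>xs. cube_hull n (set xs)) ` ?L)"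
  have finL: "finite ?L" by (rule finite_lists_length_eq[OF finite_cube])
  have "P \<inter> cube n \<in> ?G" if P: "hyperplane n P" for P
  proof -
    obtain S where S: "S \<subseteq> cube n" "card S \<le> Suc n" "S = {} \<longrightarrow> P \<inter> cube n = {}"
        "P \<inter> cube n = cube_hull n S"
      using hyperplane_trace_hull[OF P] by blast
    show ?thesis
    proof (cases "S = {}")
      case False
      \<comment> \<open>A filler from \<open>S\<close> itself keeps the padded list from enlarging
        \<open>S\<close>.\<close>
      then obtain z where "z \<in> S" by blast
      moreover obtain xs where "length xs = Suc n" "S \<subseteq> set xs" "set xs \<subseteq> insert z S"
        using list_of_length_covering[OF finite_subset[OF S(1) finite_cube] S(2)] by blast
      ultimately have "set xs = S" "xs \<in> ?L" using S(1) by auto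
      thus ?thesis using S(4) by blast
    qed (use S in simp)
  qed
  hence sub: "?F \<subseteq> ?G" by blast
  thus "finite ?F" using finL by (meson finite_imageI finite_insert finite_subset)
  have "card ?F \<le> card ?G" using finL by (intro card_mono sub) simp
  also have "\<dots> \<le> Suc (card ?L)"
    using card_image_le[OF finL, of "\<lambda>xs. cube_hull n (set xs)"] finL
    by (simp add: card_insert_if le_SucI)
  also have "card ?L = 2 ^ (n * (n + 1))"
    by (simp only: card_lists_length_eq[OF finite_cube] card_cube power_mult[symmetric] Suc_eq_plus1)
  also have "Suc (2 ^ (n * (n + 1))) \<le> (2::nat) ^ (n * (n + 1) + 1)"
    by (simp add: Suc_le_eq)
  finally show "card ?F \<le> 2 ^ (n * (n + 1) + 1)" by simp
qed

lemma ec_set_attained: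
  assumes "n > 0" "B \<subseteq> cube n"
  shows "\<exists>H. exact_cover n B H \<and> card H = ec_set n B"
  unfolding ec_set_def
  using LeastI_ex[of "\<lambda>k. \<exists>H. exact_cover n B H \<and> card H = k"] exact_cover_exists[OF assms] by blast

lemma ec_set_le_ec: "B \<subseteq> cube n \<Longrightarrow> ec_set n B \<le> ec n"
  unfolding ec_def by (intro Max_ge) (auto simp: finite_cube)

text \<open>Each of the \<open>2 ^ 2 ^ n\<close> sets of vertices is the union of a list of
  \<open>ec n\<close> traces, padded with the empty set. Bounding the number of lists and comparing
  exponents of 2 gives the claim.\<close>

lemma two_power_le_ec:
  assumes "n > 0"
  shows "2 ^ n \<le> (n * (n + 1) + 1) * ec n"
proof -
  let ?F = "insert {} {P \<inter> cube n |P. hyperplane n P}"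
  let ?L = "{xs. set xs \<subseteq> ?F \<and> length xs = ec n}"
  have finL: "finite ?L" by (rule finite_lists_length_eq[OF card_hyperplane_traces(1)])
  have "B \<in> (\<lambda>xs. \<Union>(set xs)) ` ?L" if B: "B \<subseteq> cube n" for B
  proof -
    obtain H where H: "exact_cover n B H" "card H = ec_set n B"
      using ec_set_attained[OF assms B] by blast
    let ?X = "(\<lambda>P. P \<inter> cube n) ` H"
    have finX: "finite ?X" using H(1) by (simp add: exact_cover_def)
    have "card ?X \<le> ec n"
      using H card_image_le[of H "\<lambda>P. P \<inter> cube n"] ec_set_le_ec[OF B]
      by (simp add: exact_cover_def)
    from list_of_length_covering[OF finX this, of "{}"]
    obtain xs where xs: "length xs = ec n" "?X \<subseteq> set xs" "set xs \<subseteq> insert {} ?X"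
      by (elim exE conjE)
    have "\<Union>(set xs) = \<Union>?X" using xs(2,3) by blast
    also have "\<dots> = B" using H(1) by (auto simp: exact_cover_def)
    finally have "\<Union>(set xs) = B" .
    have "insert {} ?X \<subseteq> ?F" using H(1) by (auto simp: exact_cover_def)
    hence "xs \<in> ?L" using xs(1,3) by (intro CollectI conjI) (rule order_trans)
    with \<open>\<Union>(set xs) = B\<close> show ?thesis by (intro image_eqI[of _ _ xs] sym[of _ B])
  qed
  hence "card (Pow (cube n)) \<le> card ?L"
    by (intro surj_card_le[OF finL] subsetI) (simp only: Pow_iff)
  also have "\<dots> = card ?F ^ ec n" by (rule card_lists_length_eq[OF card_hyperplane_traces(1)])
  also have "\<dots> \<le> (2 ^ (n * (n + 1) + 1)) ^ ec n"
    by (rule power_mono[OF card_hyperplane_traces(2)]) simp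
  finally have "(2::nat) ^ 2 ^ n \<le> 2 ^ ((n * (n + 1) + 1) * ec n)"
    by (simp only: card_Pow[OF finite_cube] card_cube power_mult)
  thus ?thesis by (rule power_le_imp_le_exp[rotated]) simp
qed

subsection \<open>The upper bound\<close>

text \<open>
  After reflecting \<open>d\<close> to the origin, the hyperplane has weight 1 in the directions of the
  chosen neighbours, weight 2 in the others, and value 1; a 0-1 combination of such weights equals 1
  only for a single chosen direction.
\<close>

lemma neighbours_hyperplane:
  assumes "n > 0" "d \<in> cube n"
  shows "\<exists>P. hyperplane n P \<and> P \<inter> cube n = {flip i d |i. i < n \<and> i \<in> A}"
proof -
  define w :: "nat \<Rightarrow> real" where "w i = (if i \<in> A then 1 else 2)" for i
  \<comment> \<open>The sign makes every coordinate in which a vertex differs from \<open>d\<close>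
    contribute exactly \<open>+ w i\<close>.\<close>
  define v where "v = vec n (\<lambda>i. (1 - 2 * d $ i) * w i)"
  define P where "P = {x \<in> carrier_vec n. v \<bullet> x = v \<bullet> d + 1}"
  have dc: "dim_vec d = n" using assms(2) by (simp add: cube_def)
  have "v $ 0 \<noteq> 0"
    using cube_index[OF assms(2), of 0] assms(1) by (auto simp: v_def w_def)
  hence "v \<noteq> 0\<^sub>v n"
    using assms(1) by auto
  hence hyp: "hyperplane n P"
    unfolding hyperplane_def P_def
    by (intro exI[of _ v] exI[of _ "v \<bullet> d + 1"]) (auto simp: v_def)
  have dist: "v \<bullet> x - v \<bullet> d = (\<Sum>i<n. if x $ i = d $ i then 0 else w i)" if x: "x \<in> cube n" for x
  proof -
    have "dim_vec x = n" using x by (simp add: cube_def)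
    hence "v \<bullet> x - v \<bullet> d = (\<Sum>i<n. v $ i * (x $ i - d $ i))"
      using dc by (simp add: scalar_prod_def right_diff_distrib sum_subtractf atLeast0LessThan)
    also have "\<dots> = (\<Sum>i<n. if x $ i = d $ i then 0 else w i)"
    proof (rule sum.cong[OF refl])
      fix i assume "i \<in> {..<n}"
      thus "v $ i * (x $ i - d $ i) = (if x $ i = d $ i then 0 else w i)"
        using cube_index[OF x, of i] cube_index[OF assms(2), of i] by (auto simp: v_def)
    qed
    finally show ?thesis .
  qed
  have "P \<inter> cube n = {flip i d |i. i < n \<and> i \<in> A}"
  proof (intro equalityI subsetI)
    fix x assume x: "x \<in> P \<inter> cube n"
    have xc: "dim_vec x = n" using x by (auto simp: cube_def)
    let ?t = "\<lambda>i. if x $ i = d $ i then 0 else w i"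
    have sum1: "(\<Sum>i<n. ?t i) = 1"
      using dist[of x] x by (simp add: P_def)
    hence "\<not> (\<forall>i\<in>{..<n}. ?t i = 0)"
      using sum.neutral[of "{..<n}" ?t] by linarith
    then obtain i where i: "i < n" "x $ i \<noteq> d $ i"
      by (auto split: if_splits)
    have split: "w i + (\<Sum>j\<in>{..<n} - {i}. ?t j) = 1"
      using sum1 i by (subst (asm) sum.remove[of _ i]) auto
    have nonneg: "\<forall>j\<in>{..<n} - {i}. ?t j \<ge> 0" by (simp add: w_def)
    hence "(\<Sum>j\<in>{..<n} - {i}. ?t j) \<ge> 0" by (intro sum_nonneg) blast
    hence iA: "i \<in> A" using split by (auto simp: w_def split: if_splits)
    hence "(\<Sum>j\<in>{..<n} - {i}. ?t j) = 0" using split by (simp add: w_def)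
    hence z: "\<forall>j\<in>{..<n} - {i}. ?t j = 0"
      using nonneg by (subst (asm) sum_nonneg_eq_0_iff) auto
    have other: "x $ j = d $ j" if "j < n" "j \<noteq> i" for j
      using bspec[OF z, of j] that by (simp add: w_def split: if_splits)
    have "x $ i = 1 - d $ i"
      using cube_index[of x n i] cube_index[OF assms(2), of i] i x by auto
    hence "x = flip i d"
      using other xc dc by (intro eq_vecI) (auto simp: flip_def)
    thus "x \<in> {flip i d |i. i < n \<and> i \<in> A}" using i(1) iA by blast
  next
    fix x assume "x \<in> {flip i d |i. i < n \<and> i \<in> A}"
    then obtain i where i: "x = flip i d" "i < n" "i \<in> A" by blast
    have x: "x \<in> cube n" using i(1) flip_cube[OF assms(2)] by simp
    have "x $ i \<noteq> d $ i" 
      using cube_index[OF assms(2) i(2)] i dc by (auto simp: flip_def)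
    moreover have "x $ j = d $ j" if "j < n" "j \<noteq> i" for j
      using that i dc by (simp add: flip_def)
    ultimately have "(\<Sum>j<n. if x $ j = d $ j then 0 else w j) = (\<Sum>j<n. if j = i then w j else 0)"
      by (intro sum.cong) auto
    also have "\<dots> = 1" using i by (simp add: w_def)
    finally show "x \<in> P \<inter> cube n"
      using dist[OF x] x by (simp add: P_def cube_carrier)
  qed
  with hyp show ?thesis by blast
qed

text \<open>For \<open>m = 2 ^ r\<close> this is the syndrome of a Hamming code with one free
  coordinate: the check column of position \<open>i\<close> is the binary expansion of
  \<open>i\<close>, and that of position 0 is zero.\<close>

fun syndrome :: "nat \<Rightarrow> real vec \<Rightarrow> nat" where
  "syndrome 0 x = 0"
| "syndrome (Suc m) x = xor (syndrome m x) (if x $ m = 1 then m else 0)"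

text \<open>Truncation to \<open>r\<close> bits commutes with \<open>xor\<close> and fixes every
  position below \<open>2 ^ r\<close>.\<close>

lemma take_bit_syndrome: "m \<le> 2 ^ r \<Longrightarrow> take_bit r (syndrome m x) = syndrome m x"
  by (induction m) (auto simp: take_bit_nat_eq_self)

lemma syndrome_less: "syndrome (2 ^ r) x < 2 ^ r"
  using take_bit_syndrome[of "2 ^ r" r x] by (metis order_refl take_bit_nat_less_exp)

lemma syndrome_flip:
  assumes "x \<in> cube n" "m \<le> n"
  shows "syndrome m (flip i x) = xor (syndrome m x) (if i < m then i else 0)"
  using assms(2)
proof (induction m)
  case (Suc m)
  have "dim_vec x = n" using assms(1) by (simp add: cube_def)
  hence "flip i x $ m = (if m = i then 1 - x $ m else x $ m)"
    using Suc.prems by (simp add: flip_def)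
  thus ?case
    using Suc cube_index[OF assms(1), of m]
    by (auto simp: xor.assoc less_Suc_eq) (simp_all add: xor.commute)
qed simp

text \<open>A packing argument: the syndrome of \<open>flip i d\<close> is \<open>i\<close>, so the
  flipped vertex determines the direction \<open>i\<close> and then \<open>d\<close>.\<close>

lemma card_zero_syndrome:
  assumes "2 ^ r \<le> n"
  shows "card {x \<in> cube n. syndrome (2 ^ r) x = 0} * 2 ^ r \<le> 2 ^ n"
proof -
  let ?D = "{x \<in> cube n. syndrome (2 ^ r) x = 0}"
  have "inj_on (\<lambda>(d, i). flip i d) (?D \<times> {..<2 ^ r})"
  proof (intro inj_onI, clarify)
    fix d i e j
    assume *: "d \<in> cube n" "e \<in> cube n" "syndrome (2 ^ r) d = 0" "syndrome (2 ^ r) e = 0"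
      "i < 2 ^ r" "j < 2 ^ r" "flip i d = flip j e"
    have "i = syndrome (2 ^ r) (flip i d)"
      using syndrome_flip[OF *(1) assms, of i] *(3,5) by simp
    also have "\<dots> = j"
      using syndrome_flip[OF *(2) assms, of j] *(4,6,7) by simp
    finally have "i = j" .
    moreover have "d = e" using * \<open>i = j\<close> flip_flip by metis
    ultimately show "d = e \<and> i = j" by simp
  qed
  moreover have "(\<lambda>(d, i). flip i d) ` (?D \<times> {..<2 ^ r}) \<subseteq> cube n"
    by (auto intro: flip_cube)
  ultimately have "card (?D \<times> {..<(2::nat) ^ r}) \<le> card (cube n)"
    by (rule card_inj_on_le[OF _ _ finite_cube])
  thus ?thesis by (simp add: card_cube card_cartesian_product)
qed

lemma ec_set_le_zero_syndrome:
  assumes "n > 0" "2 ^ r \<le> n" "B \<subseteq> cube n"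
  shows "ec_set n B \<le> card {x \<in> cube n. syndrome (2 ^ r) x = 0}"
proof -
  let ?D = "{x \<in> cube n. syndrome (2 ^ r) x = 0}"
  have finD: "finite ?D" using finite_cube by simp
  let ?N = "\<lambda>d. {flip i d |i. i < n \<and> i \<in> {i. flip i d \<in> B}}"
  have "\<forall>d\<in>?D. \<exists>P. hyperplane n P \<and> P \<inter> cube n = ?N d"
    using neighbours_hyperplane[OF assms(1)] by blast
  from bchoice[OF this]
  obtain f where "\<forall>d\<in>?D. hyperplane n (f d) \<and> f d \<inter> cube n = ?N d"
    by (elim exE)
  hence f: "hyperplane n (f d)" "f d \<inter> cube n = ?N d" if "d \<in> ?D" for d
    using that by blast+
  have "\<Union>(f ` ?D) \<inter> cube n = B"
  proof (intro equalityI subsetI)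
    fix x assume "x \<in> \<Union>(f ` ?D) \<inter> cube n"
    then obtain d where d: "d \<in> ?D" "x \<in> f d \<inter> cube n" by blast
    show "x \<in> B" using d(2) unfolding f(2)[OF d(1)] by auto
  next
    fix x assume x: "x \<in> B"
    hence xc: "x \<in> cube n" using assms(3) by blast
    \<comment> \<open>Flipping at the syndrome cancels it. If it is already 0, flipping position 0
      leaves it 0, so \<open>x\<close> is still a neighbour of a vertex of
      \<open>?D\<close>.\<close>
    define i where "i = syndrome (2 ^ r) x"
    have i: "i < 2 ^ r" by (simp add: i_def syndrome_less)
    have D: "flip i x \<in> ?D"
      using syndrome_flip[OF xc assms(2), of i] i flip_cube[OF xc] by (simp add: i_def[symmetric])
    have "x \<in> f (flip i x) \<inter> cube n"
      unfolding f(2)[OF D] using flip_flip[OF xc, of i] x i assms(2)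
      by (auto intro!: exI[of _ i])
    thus "x \<in> \<Union>(f ` ?D) \<inter> cube n" using D by blast
  qed
  hence "exact_cover n B (f ` ?D)"
    using f(1) finD by (auto simp: exact_cover_def)
  hence "ec_set n B \<le> card (f ` ?D)"
    unfolding ec_set_def by (intro Least_le) blast
  also have "\<dots> \<le> card ?D" by (rule card_image_le[OF finD])
  finally show ?thesis .
qed

text \<open>Rounding \<open>n\<close> down to a power of two loses a factor less than 2, hence the
  exponent \<open>n + 1\<close>.\<close>

lemma ec_mult_le:
  assumes "n > 0"
  shows "ec n * n \<le> 2 ^ (n + 1)"
proof -
  obtain r where r: "2 ^ r \<le> n" "n < 2 ^ (r + 1)"
    using ex_power_ivl1[of 2 n] assms by auto
  have "ec n \<in> ec_set n ` Pow (cube n)"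
    unfolding ec_def by (intro Max_in) (auto simp: finite_cube)
  hence "ec n \<le> card {x \<in> cube n. syndrome (2 ^ r) x = 0}"
    using ec_set_le_zero_syndrome[OF assms r(1)] by auto
  hence le: "ec n * 2 ^ r \<le> 2 ^ n"
    using card_zero_syndrome[OF r(1)] by (meson le_trans mult_le_mono1)
  have "ec n * n \<le> ec n * 2 ^ (r + 1)"
    using r(2) by (intro mult_le_mono2) simp
  also have "\<dots> = 2 * (ec n * 2 ^ r)" by simp
  also have "\<dots> \<le> 2 * 2 ^ n" using le by (rule mult_le_mono2)
  finally show ?thesis by simp
qed

theorem theorem2:
  fixes n :: nat
  assumes "n > 0"
  shows "2 powi (int n - 2) / (real n)^2 \<le> real (ec n) \<and> real (ec n) \<le> 2 ^ (n + 1) / real n"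
proof
  \<comment> \<open>These bound \<open>n * (n + 1) + 1\<close> by \<open>3 * (n * n)\<close>; the
    weaker constant 4 yields the exponent \<open>n - 2\<close>.\<close>
  have "n \<le> n * n" "1 \<le> n * n" using assms by auto
  hence "n * (n + 1) + 1 \<le> 4 * (n * n)" unfolding distrib_left mult_1_right by linarith
  hence "2 ^ n \<le> 4 * (n * n) * ec n"
    using two_power_le_ec[OF assms] by (meson le_trans mult_le_mono1)
  hence "real (2 ^ n) \<le> real (4 * (n * n) * ec n)"
    by (rule of_nat_mono)
  moreover have "2 powi (int n - 2) = (2::real) ^ n / 4"
    by (simp add: power_int_diff)
  ultimately show "2 powi (int n - 2) / (real n)^2 \<le> real (ec n)"
    using assms by (simp add: field_simps power2_eq_square)
next
  have "real (ec n * n) \<le> real (2 ^ (n + 1))"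
    using ec_mult_le[OF assms] by (rule of_nat_mono)
  thus "real (ec n) \<le> 2 ^ (n + 1) / real n"
    using assms by (simp add: field_simps)
qed

end
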